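(* Let $P\subset\mathbb{R}^2$ be an origin symmetric polygon and let $S\subset\mathbb{R}^2$ be a square centered at the origin. Then $\mathcal{P}(P)\geq \mathcal{P}(S)$.
   Context: A polygon here is the convex hull of finitely many points of $\mathbb{R}^2$ with non-empty interior; it is origin symmetric if $P=-P$. The polar body of a compact convex set $K\subset\mathbb{R}^2$ containing the origin in its interior is $K^{\ast}=\{x\in\mathbb{R}^2 : x\cdot y\leq 1 \text{ for all } y\in K\}$. Write $V$ for area (2-dimensional volume). The volume-product of $K$ is $\mathcal{P}(K)=V(K)\,V(K^{\ast})$. *)

theory Defs
  imports "HOL-Analysis.Analysis"
begin

definition polygon :: "(real^2) set \<Rightarrow> bool" where
  "polygon P \<longleftrightarrow> polytope P \<and> interior P \<noteq> {}"

definition origin_symmetric :: "'a::real_vector set \<Rightarrow> bool" where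
  "origin_symmetric P \<longleftrightarrow> P = uminus ` P"

definition polar_body :: "'a::real_inner set \<Rightarrow> 'a set" where
  "polar_body K = {x. \<forall>y\<in>K. x \<bullet> y \<le> 1}"

text \<open>Meaningful for compact convex \<open>K\<close> with the origin in its interior: then both
  \<open>K\<close> and its polar body are compact, so that neither area is infinite
  (\<^const>\<open>measure\<close> sends infinite values to 0).\<close>
definition volume_product :: "(real^2) set \<Rightarrow> real" where
  "volume_product K = measure lebesgue K * measure lebesgue (polar_body K)"

text \<open>A non-degenerate filled square with centre \<open>c\<close>, of side length \<open>2 * h\<close>, with sides
  parallel to the orthonormal vectors \<open>e\<close> and \<open>f\<close>.\<close>
definition square_centered_at :: "real^2 \<Rightarrow> (real^2) set \<Rightarrow> bool" where
  "square_centered_at c S \<longleftrightarrow>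
     (\<exists>e f h. norm e = 1 \<and> norm f = 1 \<and> orthogonal e f \<and> h > 0 \<and>
        S = {c + s *\<^sub>R e + t *\<^sub>R f | s t. \<bar>s\<bar> \<le> h \<and> \<bar>t\<bar> \<le> h})"

end

theory Submission
  imports Defs
begin

text \<open>The square has volume product 8, and every symmetric convex body \<open>K\<close> of the plane has volume
  product at least 8. The lower bound compares areas of inscribed triangles, first in \<open>K\<close> and
  then in its polar body.

  Write \<open>V\<close> for the area of \<open>K\<close>. By the intermediate value theorem there are two lines through
  the origin that cut \<open>K\<close> into four parts of area \<open>V/4\<close> (\<open>exists_equipartition\<close>); let them meet
  the boundary of \<open>K\<close> at \<open>\<plusminus>u\<close> and \<open>\<plusminus>v\<close>. For \<open>x\<close> in the part between \<open>u\<close> and \<open>v\<close>, the triangles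
  \<open>0 u x\<close> and \<open>0 x v\<close> lie in this part and do not overlap, so their total area is at most \<open>V/4\<close>.
  The same argument in the other parts gives \<open>|u \<times> x| + |v \<times> x| \<le> V/2\<close> for every \<open>x\<close> in \<open>K\<close>,
  where \<open>\<times>\<close> is the scalar cross product (\<open>equipartition_cross2_bound\<close>). Read as a statement about
  linear functionals, this says that the polar body contains \<open>\<plusminus>p\<close> and \<open>\<plusminus>q\<close>, where \<open>p\<close> represents
  \<open>(2/V) (u \<times> x - v \<times> x)\<close> and \<open>q\<close> represents \<open>(2/V) (u \<times> x + v \<times> x)\<close>. The polar body also contains
  functionals \<open>a\<close> and \<open>b\<close> that support \<open>K\<close> at \<open>u\<close> and \<open>v\<close>, that is \<open>a \<bullet> u = b \<bullet> v = 1\<close>.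

  The points \<open>-q, a, p, b, q, -a, -p, -b\<close> are in angular order, so the polar body contains eight
  non-overlapping triangles with a vertex at the origin, one for each pair of cyclic neighbours.
  Their areas depend on the unknown numbers \<open>a \<bullet> v\<close> and \<open>b \<bullet> u\<close>, but in the two triangles that
  meet along \<open>a\<close> these numbers cancel, and likewise for \<open>b\<close>. The total area is exactly \<open>8/V\<close>.\<close>

section \<open>Cross products and wedges in the plane\<close>

definition cross2 :: "real^2 \<Rightarrow> real^2 \<Rightarrow> real" where
  "cross2 x y = x$1 * y$2 - x$2 * y$1"

text \<open>Rotation by a right angle turns cross products into inner products, and so vectors into points of
  the polar body: \<open>x \<times> w = x \<bullet> rotate_cw w\<close>.\<close>
definition rotate_cw :: "real^2 \<Rightarrow> real^2" where
  "rotate_cw w = vector [w$2, - w$1]"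

text \<open>For \<open>cross2 u v > 0\<close> this is the closed convex cone spanned by \<open>u\<close> and \<open>v\<close>.\<close>
definition wedge :: "real^2 \<Rightarrow> real^2 \<Rightarrow> (real^2) set" where
  "wedge u v = {x. cross2 u x \<ge> 0 \<and> cross2 x v \<ge> 0}"

lemma inner_2: "x \<bullet> y = x$1 * y$1 + x$2 * y$2" for x y :: "real^2"
  by (simp add: inner_vec_def sum_2)

lemmas plane_simps = cross2_def rotate_cw_def inner_2 vector_2

lemma cross2_eq_inner: "cross2 u x = (- rotate_cw u) \<bullet> x"
  by (simp add: plane_simps)

lemma cross2_zero_self [simp]: "cross2 0 x = 0" "cross2 x 0 = 0" "cross2 x x = 0"
  by (simp_all add: cross2_def)

lemma cross2_uminus [simp]: "cross2 (- x) y = - cross2 x y" "cross2 x (- y) = - cross2 x y"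
  by (simp_all add: cross2_def)

lemma cross2_commute: "cross2 x y = - cross2 y x"
  by (simp add: cross2_def)

lemma closed_cross2_halfplanes:
  "closed {x. cross2 u x \<ge> 0}" "closed {x. cross2 u x \<le> 0}"
  unfolding cross2_eq_inner
  by (simp_all add: closed_halfspace_ge closed_halfspace_le del: inner_minus_left)

lemma wedge_eq: "wedge u v = {x. cross2 u x \<ge> 0} \<inter> {x. cross2 v x \<le> 0}"
  by (auto simp: wedge_def cross2_commute[of _ v])

lemma lmeasurable_Int_closed:
  assumes "K \<in> lmeasurable" "closed T"
  shows "K \<inter> T \<in> lmeasurable"
  using assms by (simp add: fmeasurable_Int_fmeasurable borel_closed)

lemma negligible_cross2_line:
  assumes "u \<noteq> 0"
  shows "negligible {x. cross2 u x = 0}"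
proof -
  have "- rotate_cw u \<noteq> 0"
    using assms by (auto simp: vec_eq_iff forall_2 plane_simps)
  then show ?thesis
    unfolding cross2_eq_inner by (intro negligible_hyperplane) blast
qed

text \<open>The two closed half-planes of a line overlap only in the line, which has area 0.\<close>
lemma measure_split_cross2:
  assumes "K \<in> lmeasurable" "w \<noteq> 0"
  shows "measure lebesgue K = measure lebesgue (K \<inter> {x. cross2 w x \<ge> 0})
                            + measure lebesgue (K \<inter> {x. cross2 w x \<le> 0})"
proof -
  have "measure lebesgue K = measure lebesgue (K \<inter> {x. cross2 w x \<ge> 0})
                           + measure lebesgue (K \<inter> {x. cross2 w x \<le> 0})
                           + measure lebesgue ({} :: (real^2) set)"
  proof (rule measure_Un3_negligible)
    show "negligible (K \<inter> {x. cross2 w x \<ge> 0} \<inter> (K \<inter> {x. cross2 w x \<le> 0}))"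
      by (rule negligible_subset[OF negligible_cross2_line[OF assms(2)]]) auto
  qed (use assms(1) closed_cross2_halfplanes in \<open>auto intro!: lmeasurable_Int_closed\<close>)
  then show ?thesis by simp
qed

lemma measure_uminus:
  fixes S :: "(real^2) set"
  assumes "S \<in> lmeasurable"
  shows "measure lebesgue (uminus ` S) = measure lebesgue S"
proof -
  have "orthogonal_transformation (uminus :: real^2 \<Rightarrow> real^2)"
    by (auto simp: orthogonal_transformation linear_uminus)
  then show ?thesis using assms by (rule measure_orthogonal_image)
qed

text \<open>The lines through \<open>u\<close> and \<open>v\<close> cut \<open>K\<close> into four parts, and reflection in the origin exchanges
  opposite ones; two adjacent parts therefore make up half of the area.\<close>
lemma measure_symmetric_eq_wedges:
  assumes K: "K \<in> lmeasurable" "origin_symmetric K" and "u \<noteq> 0" "v \<noteq> 0"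
  shows "measure lebesgue K =
           2 * (measure lebesgue (K \<inter> wedge u v) + measure lebesgue (K \<inter> wedge v (- u)))"
proof -
  let ?H = "K \<inter> {x. cross2 u x \<ge> 0}"
  have H: "?H \<in> lmeasurable"
    using K(1) closed_cross2_halfplanes(1) by (rule lmeasurable_Int_closed)
  have sym: "- x \<in> K \<longleftrightarrow> x \<in> K" for x
    using K(2) unfolding origin_symmetric_def by (metis image_iff minus_minus)
  have "K \<inter> {x. cross2 u x \<le> 0} = uminus ` ?H"
  proof (intro set_eqI iffI)
    fix x assume x: "x \<in> K \<inter> {x. cross2 u x \<le> 0}"
    then have "- x \<in> ?H" by (auto simp: sym cross2_def)
    then show "x \<in> uminus ` ?H" by (metis imageI minus_minus)
  qed (auto simp: sym cross2_def)
  then have "measure lebesgue K = 2 * measure lebesgue ?H"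
    using measure_split_cross2[OF K(1) \<open>u \<noteq> 0\<close>] measure_uminus[OF H] by simp
  also have "measure lebesgue ?H =
      measure lebesgue (K \<inter> wedge v (- u)) + measure lebesgue (K \<inter> wedge u v)"
  proof -
    have "?H \<inter> {x. cross2 v x \<ge> 0} = K \<inter> wedge v (- u)"
         "?H \<inter> {x. cross2 v x \<le> 0} = K \<inter> wedge u v"
      by (auto simp: wedge_eq)
    then show ?thesis
      using measure_split_cross2[OF H \<open>v \<noteq> 0\<close>] by simp
  qed
  finally show ?thesis by simp
qed

section \<open>Inscribed triangles\<close>

lemma measure_triangle_at_0:
  "measure lebesgue (convex hull {0, u, v}) = \<bar>cross2 u v\<bar> / 2"
  for u v :: "real^2"
proof -
  have "convex hull {0, u, v} \<in> sets borel"
    by (simp add: borel_compact compact_convex_hull)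
  then have "measure lebesgue (convex hull {0, u, v}) = measure lborel (convex hull {0, u, v})"
    by simp
  also have "\<dots> = \<bar>cross2 u v\<bar> / 2"
    by (subst content_triangle) (simp add: cross2_def abs_minus_commute mult.commute)
  finally show ?thesis .
qed

lemma convex_wedge: "convex (wedge u v)"
  unfolding wedge_eq cross2_eq_inner
  by (intro convex_Int) (simp_all add: convex_halfspace_ge convex_halfspace_le del: inner_minus_left)

text \<open>The triangles \<open>0 u w\<close> and \<open>0 w v\<close> lie on different sides of the line through \<open>w\<close>, and both lie
  in the wedge. Every lower bound for an area below comes from here, for the body as for its polar body.\<close>
lemma measure_wedge_ge_fan:
  assumes K: "convex K" "K \<in> lmeasurable" "{0, u, w, v} \<subseteq> K"
    and pos: "cross2 u w \<ge> 0" "cross2 w v \<ge> 0" "cross2 u v \<ge> 0"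
  shows "measure lebesgue (K \<inter> wedge u v) \<ge> (cross2 u w + cross2 w v) / 2"
proof (cases "w = 0")
  case True
  then show ?thesis by (simp add: cross2_def)
next
  case False
  let ?S = "convex hull {0, u, w}" and ?T = "convex hull {0, w, v}"
  let ?W = "K \<inter> wedge u v"
  have W: "?W \<in> lmeasurable"
    unfolding wedge_eq by (intro lmeasurable_Int_closed closed_Int closed_cross2_halfplanes K)
  have conv: "convex ?W"
    by (intro convex_Int K(1) convex_wedge)
  have sub: "?S \<subseteq> ?W" "?T \<subseteq> ?W"
    using K(3) pos by (intro hull_minimal conv; auto simp: wedge_def)+
  have "?S \<subseteq> wedge u w" "?T \<subseteq> wedge w v"
    using pos by (intro hull_minimal convex_wedge; auto simp: wedge_def)+
  then have sides: "?S \<inter> ?T \<subseteq> {x. cross2 w x = 0}"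
    by (fastforce simp: wedge_def cross2_commute[of _ w])
  have meas: "?S \<in> lmeasurable" "?T \<in> lmeasurable"
    by (auto intro!: lmeasurable_compact compact_convex_hull)
  have "measure lebesgue (?S \<union> ?T) = measure lebesgue ?S + measure lebesgue ?T
                                     + measure lebesgue ({} :: (real^2) set)"
    using negligible_subset[OF negligible_cross2_line[OF False] sides] meas
    by (intro measure_Un3_negligible) auto
  then have "measure lebesgue (?S \<union> ?T) = (cross2 u w + cross2 w v) / 2"
    using pos by (simp add: measure_triangle_at_0 add_divide_distrib)
  moreover have "measure lebesgue (?S \<union> ?T) \<le> measure lebesgue ?W"
    using sub meas W by (intro measure_mono_fmeasurable) auto
  ultimately show ?thesis by linarith
qed

section \<open>Equipartition by two lines\<close>

text \<open>When the half-plane turns, the indicator function of the part that it cuts off converges at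
  every point outside the limiting line, so dominated convergence applies.\<close>
lemma continuous_on_measure_halfplane:
  fixes w :: "real \<Rightarrow> real^2"
  assumes L: "L \<in> lmeasurable" and w: "continuous_on T w" "\<And>s. s \<in> T \<Longrightarrow> w s \<noteq> 0"
  shows "continuous_on T (\<lambda>s. measure lebesgue (L \<inter> {x. cross2 (w s) x \<le> 0}))"
  unfolding continuous_on_sequentially
proof (intro allI ballI impI, elim conjE)
  fix X a assume a: "a \<in> T" and X: "\<forall>n. X n \<in> T" "X \<longlonglongrightarrow> a"
  let ?A = "\<lambda>s. L \<inter> {x. cross2 (w s) x \<le> 0}"
  have meas: "?A s \<in> lmeasurable" for s
    using L closed_cross2_halfplanes(2) by (rule lmeasurable_Int_closed)
  have wX: "(\<lambda>n. w (X n)) \<longlonglongrightarrow> w a"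
    using w(1) a X by (auto simp: continuous_on_sequentially o_def)
  have "(\<lambda>n. integral\<^sup>L lebesgue (indicat_real (?A (X n)))) \<longlonglongrightarrow>
        integral\<^sup>L lebesgue (indicat_real (?A a))"
  proof (rule integral_dominated_convergence[where w = "indicat_real L"])
    show "integrable lebesgue (indicat_real L)"
      using L by (simp add: lmeasurable_iff_integrable)
    have "AE x in lebesgue. x \<notin> {x. cross2 (w a) x = 0}"
      using negligible_cross2_line[OF w(2)[OF a]]
      by (intro AE_not_in) (simp add: negligible_iff_null_sets)
    then show "AE x in lebesgue. (\<lambda>n. indicat_real (?A (X n)) x) \<longlonglongrightarrow> indicat_real (?A a) x"
    proof eventually_elim
      case (elim x)
      have lim: "(\<lambda>n. cross2 (w (X n)) x) \<longlonglongrightarrow> cross2 (w a) x"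
        unfolding cross2_def by (intro tendsto_intros wX)
      have "\<forall>\<^sub>F n in sequentially. (cross2 (w (X n)) x \<le> 0) = (cross2 (w a) x \<le> 0)"
      proof (cases "cross2 (w a) x < 0")
        case True
        show ?thesis
          using order_tendstoD(2)[OF lim True] by eventually_elim (use True in auto)
      next
        case False
        then have gt: "0 < cross2 (w a) x" using elim by auto
        show ?thesis
          using order_tendstoD(1)[OF lim gt] by eventually_elim (use False elim in auto)
      qed
      then have "\<forall>\<^sub>F n in sequentially. indicat_real (?A (X n)) x = indicat_real (?A a) x"
        by eventually_elim (auto simp: indicator_def)
      then show ?case by (rule tendsto_eventually)
    qed
  qed (use meas in \<open>auto simp: indicator_def\<close>)
  then show "((\<lambda>s. measure lebesgue (?A s)) \<circ> X) \<longlonglongrightarrow> measure lebesgue (?A a)"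
    using meas by (simp add: o_def)
qed

text \<open>Fix one line along the first axis and turn the other one. The area between the two rays in the
  upper half-plane grows continuously from 0 to half of the area of \<open>K\<close>, so it is a quarter of it
  at some moment; the remaining part of the upper half is then a quarter, too.\<close>
lemma exists_equipartition:
  fixes K :: "(real^2) set"
  assumes K: "K \<in> lmeasurable" "origin_symmetric K" and pos: "measure lebesgue K > 0"
  obtains u v where "cross2 u v > 0"
    "measure lebesgue (K \<inter> wedge u v) = measure lebesgue K / 4"
    "measure lebesgue (K \<inter> wedge v (- u)) = measure lebesgue K / 4"
proof -
  define u :: "real^2" where "u = axis 1 1"
  \<comment> \<open>The upper half of the unit circle of the \<open>l\<^sup>1\<close> norm, traversed from \<open>u\<close> at \<open>s = -1\<close> to \<open>- u\<close>
    at \<open>s = 1\<close>.\<close>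
  define v :: "real \<Rightarrow> real^2" where "v s = (- s) *\<^sub>R axis 1 1 + (1 - \<bar>s\<bar>) *\<^sub>R axis 2 1" for s
  let ?L = "K \<inter> {x. cross2 u x \<ge> 0}"
  let ?f = "\<lambda>s. measure lebesgue (?L \<inter> {x. cross2 (v s) x \<le> 0})"
  have u0: "u \<noteq> 0" by (simp add: u_def axis_eq_0_iff)
  have v0: "v s \<noteq> 0" for s
    by (auto simp: v_def vec_eq_iff forall_2 axis_def)
  have L: "?L \<in> lmeasurable"
    using K(1) closed_cross2_halfplanes(1) by (rule lmeasurable_Int_closed)
  have wedge: "?L \<inter> {x. cross2 (v s) x \<le> 0} = K \<inter> wedge u (v s)" for s
    by (auto simp: wedge_eq)
  have "?f (-1) = 0"
  proof -
    have "?L \<inter> {x. cross2 (v (-1)) x \<le> 0} \<subseteq> {x. cross2 u x = 0}"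
      by (auto simp: u_def v_def cross2_def axis_def)
    then show ?thesis
      by (intro negligible_imp_measure0 negligible_subset[OF negligible_cross2_line[OF u0]])
  qed
  moreover have "?f 1 = measure lebesgue K / 2"
  proof -
    have "v 1 = - u" by (simp add: u_def v_def)
    then have "K \<inter> wedge u (v 1) = ?L" "K \<inter> wedge (v 1) (- u) \<subseteq> {x. cross2 u x = 0}"
      by (auto simp: wedge_eq)
    moreover from this have "measure lebesgue (K \<inter> wedge (v 1) (- u)) = 0"
      by (intro negligible_imp_measure0 negligible_subset[OF negligible_cross2_line[OF u0]])
    ultimately show ?thesis
      using measure_symmetric_eq_wedges[OF K u0 v0[of 1]] by (simp add: wedge)
  qed
  moreover have "continuous_on {-1..1} ?f"
    by (rule continuous_on_measure_halfplane[OF L _ v0]) (auto simp: v_def intro!: continuous_intros)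
  ultimately obtain s where s: "-1 \<le> s" "s \<le> 1" "?f s = measure lebesgue K / 4"
    using IVT'[of ?f "-1" "measure lebesgue K / 4" 1] pos by auto
  have "s \<noteq> -1" "s \<noteq> 1"
    using s(3) \<open>?f (-1) = 0\<close> \<open>?f 1 = measure lebesgue K / 2\<close> pos by auto
  then have "cross2 u (v s) > 0"
    using s by (auto simp: u_def v_def cross2_def axis_def)
  moreover have "measure lebesgue (K \<inter> wedge u (v s)) = measure lebesgue K / 4"
    using s(3) by (simp add: wedge)
  moreover have "measure lebesgue (K \<inter> wedge (v s) (- u)) = measure lebesgue K / 4"
    using calculation(2) measure_symmetric_eq_wedges[OF K u0 v0[of s]] by simp
  ultimately show ?thesis by (rule that)
qed

lemma wedge_scaleR:
  assumes "a > 0" "b > 0"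
  shows "wedge (a *\<^sub>R u) (b *\<^sub>R v) = wedge u v"
proof -
  have "cross2 (a *\<^sub>R u) x = a * cross2 u x" "cross2 x (b *\<^sub>R v) = b * cross2 x v" for x
    by (simp_all add: cross2_def algebra_simps)
  then show ?thesis
    using assms by (simp add: wedge_def zero_le_mult_iff)
qed

section \<open>Polar bodies\<close>

lemma origin_symmetric_iff: "origin_symmetric K \<longleftrightarrow> (\<forall>x\<in>K. - x \<in> K)"
  unfolding origin_symmetric_def by (force simp: image_iff intro: minus_minus[symmetric])

lemma polar_body_eq_Inter: "polar_body K = (\<Inter>y\<in>K. {x. y \<bullet> x \<le> 1})"
  by (auto simp: polar_body_def inner_commute)

lemma convex_polar_body: "convex (polar_body K)"
  unfolding polar_body_eq_Inter by (auto intro!: convex_INT convex_halfspace_le)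

lemma closed_polar_body: "closed (polar_body K)"
  unfolding polar_body_eq_Inter by (auto intro!: closed_INT closed_halfspace_le)

lemma origin_symmetric_polar_body:
  "origin_symmetric K \<Longrightarrow> origin_symmetric (polar_body K)"
  unfolding origin_symmetric_iff polar_body_def
  by (simp flip: inner_minus_right)

text \<open>If \<open>K\<close> contains the ball of radius \<open>r\<close>, testing a polar point \<open>x\<close> against the point of the ball
  in the direction of \<open>x\<close> gives \<open>r * norm x \<le> 1\<close>.\<close>
lemma bounded_polar_body:
  fixes K :: "'a::euclidean_space set"
  assumes "0 \<in> interior K"
  shows "bounded (polar_body K)"
proof -
  obtain r where r: "r > 0" "cball 0 r \<subseteq> K"
    using assms mem_interior_cball by blast
  have "norm x \<le> 1 / r" if "x \<in> polar_body K" for x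
  proof (cases "x = 0")
    case False
    have "(r / norm x) *\<^sub>R x \<in> K" using r False by (intro subsetD[OF r(2)]) auto
    then have "x \<bullet> ((r / norm x) *\<^sub>R x) \<le> 1" using that by (auto simp: polar_body_def)
    moreover have "x \<bullet> x = norm x * norm x"
      by (metis dot_square_norm power2_eq_square)
    ultimately have "r * norm x \<le> 1"
      using False by simp
    then show ?thesis
      using r by (simp add: pos_le_divide_eq mult.commute)
  qed (use r in auto)
  then show ?thesis unfolding bounded_iff by blast
qed

text \<open>A supporting functional at \<open>u\<close> does not vanish at \<open>u\<close> because it separates \<open>u\<close> from the interior
  point 0, so it can be normalised to the value 1 there.\<close>
lemma supporting_functional_in_polar_body:
  fixes K :: "'a::euclidean_space set"
  assumes "convex K" "closed K" "0 \<in> interior K" "u \<in> frontier K"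
  obtains a where "a \<in> polar_body K" "a \<bullet> u = 1"
proof -
  have ri: "rel_interior K = interior K"
    using assms(3) by (intro rel_interior_nonempty_interior) auto
  have "u \<in> K" "u \<notin> rel_interior K"
    using assms(2,4) ri by (auto simp: frontier_def)
  then obtain a where a: "\<And>y. y \<in> K \<Longrightarrow> a \<bullet> u \<le> a \<bullet> y"
      "\<And>y. y \<in> rel_interior K \<Longrightarrow> a \<bullet> u < a \<bullet> y"
    using supporting_hyperplane_rel_boundary[OF assms(1)] by metis
  have neg: "a \<bullet> u < 0" using a(2)[of 0] assms(3) ri by simp
  let ?a = "(1 / (a \<bullet> u)) *\<^sub>R a"
  have "?a \<in> polar_body K"
    using a(1) neg by (auto simp: polar_body_def divide_simps)
  moreover have "?a \<bullet> u = 1" using neg by simp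
  ultimately show ?thesis by (rule that)
qed

section \<open>The lower bound for symmetric convex bodies\<close>

text \<open>In each of the four parts, the left-hand side is twice the area of the two triangles with apex 0
  that \<open>x\<close> forms with the neighbouring points among \<open>u\<close>, \<open>v\<close>, \<open>- u\<close>, \<open>- v\<close>. These triangles lie in
  a part of area \<open>V/4\<close>.\<close>
lemma equipartition_cross2_bound:
  assumes K: "convex K" "K \<in> lmeasurable" "origin_symmetric K" "{0, u, v} \<subseteq> K"
    and uv: "cross2 u v > 0"
    and eq: "measure lebesgue (K \<inter> wedge u v) = measure lebesgue K / 4"
            "measure lebesgue (K \<inter> wedge v (- u)) = measure lebesgue K / 4"
    and x: "x \<in> K"
  shows "\<bar>cross2 u x\<bar> + \<bar>cross2 v x\<bar> \<le> measure lebesgue K / 2"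
proof -
  have sym: "- y \<in> K" if "y \<in> K" for y
    using K(3) that by (simp add: origin_symmetric_iff)
  have upper: "\<bar>cross2 u y\<bar> + \<bar>cross2 v y\<bar> \<le> measure lebesgue K / 2"
    if y: "y \<in> K" "cross2 u y \<ge> 0" for y
  proof (cases "cross2 v y \<le> 0")
    case True
    have "(cross2 u y + cross2 y v) / 2 \<le> measure lebesgue (K \<inter> wedge u v)"
      using K y uv True by (intro measure_wedge_ge_fan) (auto simp: cross2_commute[of y v])
    then show ?thesis using eq(1) y True cross2_commute[of y v] by simp
  next
    case False
    have "(cross2 v y + cross2 y (- u)) / 2 \<le> measure lebesgue (K \<inter> wedge v (- u))"
      using K y uv False sym[of u] cross2_commute[of y u] cross2_commute[of v u]
      by (intro measure_wedge_ge_fan) auto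
    moreover have "cross2 y (- u) = cross2 u y" by (simp add: cross2_commute[of y u])
    ultimately show ?thesis using eq(2) y False by simp
  qed
  show ?thesis
  proof (cases "cross2 u x \<ge> 0")
    case False
    then have "\<bar>cross2 u (- x)\<bar> + \<bar>cross2 v (- x)\<bar> \<le> measure lebesgue K / 2"
      by (intro upper sym x) simp
    then show ?thesis by simp
  qed (use upper x in blast)
qed

text \<open>Mahler's inequality in the plane. The equipartition bound and the supporting functionals at the
  four points where the cutting lines meet the boundary provide the eight points of the polar body
  whose triangles add up to area \<open>8/V\<close>.\<close>
theorem volume_product_symmetric_convex_ge_8:
  fixes K :: "(real^2) set"
  assumes "convex K" "compact K" "origin_symmetric K" "0 \<in> interior K"
  shows "volume_product K \<ge> 8"
proof -
  let ?V = "measure lebesgue K"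
  have K: "K \<in> lmeasurable" using assms(2) by (rule lmeasurable_compact)
  have V: "?V > 0"
  proof -
    have "\<not> negligible K"
      using assms(4) open_not_negligible[OF open_interior, of K] negligible_subset interior_subset
      by blast
    then show ?thesis
      using K by (metis negligible_iff_measure measure_nonneg order_le_less)
  qed
  obtain u' v' where uv': "cross2 u' v' > 0"
      "measure lebesgue (K \<inter> wedge u' v') = ?V / 4"
      "measure lebesgue (K \<inter> wedge v' (- u')) = ?V / 4"
    using exists_equipartition[OF K assms(3) V] by blast
  have nz: "u' \<noteq> 0" "v' \<noteq> 0" using uv'(1) by (auto simp: cross2_def)
  have "bounded K" using assms(2) by (rule compact_imp_bounded)
  note ray = ray_to_frontier[OF this assms(4)]
  obtain r where r: "r > 0" "r *\<^sub>R u' \<in> frontier K" using ray[OF nz(1)] by auto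
  obtain t where t: "t > 0" "t *\<^sub>R v' \<in> frontier K" using ray[OF nz(2)] by auto
  define u v where "u = r *\<^sub>R u'" and "v = t *\<^sub>R v'"
  have "cross2 u v = r * t * cross2 u' v'"
    by (simp add: u_def v_def cross2_def algebra_simps)
  then have uv: "cross2 u v > 0" using uv'(1) r(1) t(1) by simp
  have eq: "measure lebesgue (K \<inter> wedge u v) = ?V / 4"
           "measure lebesgue (K \<inter> wedge v (- u)) = ?V / 4"
    using uv' wedge_scaleR[OF r(1) t(1), of u' v'] wedge_scaleR[OF t(1) r(1), of v' "- u'"]
    by (simp_all add: u_def v_def)
  have closed: "closed K" using assms(2) by (rule compact_imp_closed)
  have fr: "u \<in> frontier K" "v \<in> frontier K" using r t by (simp_all add: u_def v_def)
  then have inK: "u \<in> K" "v \<in> K" "0 \<in> K"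
    using closed assms(4) interior_subset by (auto simp: frontier_def)
  obtain a where a: "a \<in> polar_body K" "a \<bullet> u = 1"
    using supporting_functional_in_polar_body[OF assms(1) closed assms(4) fr(1)] .
  obtain b where b: "b \<in> polar_body K" "b \<bullet> v = 1"
    using supporting_functional_in_polar_body[OF assms(1) closed assms(4) fr(2)] .

  \<comment> \<open>As functionals, \<open>p\<close> and \<open>q\<close> are \<open>2 / V\<close> times the difference and the sum of \<open>cross2 u\<close> and
    \<open>cross2 v\<close>, so the equipartition bound puts them into the polar body.\<close>
  define p q where "p = (2 / ?V) *\<^sub>R rotate_cw (v - u)" and "q = - (2 / ?V) *\<^sub>R rotate_cw (u + v)"
  have bound: "\<bar>cross2 u x\<bar> + \<bar>cross2 v x\<bar> \<le> ?V / 2" if "x \<in> K" for x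
    using inK that by (intro equipartition_cross2_bound assms K uv eq) auto
  have pq: "p \<in> polar_body K" "q \<in> polar_body K"
  proof -
    have "p \<bullet> x = (2 / ?V) * (cross2 u x - cross2 v x)"
         "q \<bullet> x = (2 / ?V) * (cross2 u x + cross2 v x)" for x
      by (simp_all add: p_def q_def plane_simps add_divide_distrib diff_divide_distrib algebra_simps)
    moreover have "(2 / ?V) * (cross2 u x - cross2 v x) \<le> 1"
                  "(2 / ?V) * (cross2 u x + cross2 v x) \<le> 1" if "x \<in> K" for x
      using bound[OF that] V by (auto simp: field_simps)
    ultimately show "p \<in> polar_body K" "q \<in> polar_body K"
      by (auto simp: polar_body_def)
  qed
  have sym: "origin_symmetric (polar_body K)"
    using assms(3) by (rule origin_symmetric_polar_body)
  have K': "polar_body K \<in> lmeasurable"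
    by (intro measurable_convex convex_polar_body bounded_polar_body assms)
  have 0: "0 \<in> polar_body K" by (simp add: polar_body_def)

  have "- u \<in> K" "- v \<in> K" using inK assms(3) by (auto simp: origin_symmetric_iff)
  then have "a \<bullet> v \<le> 1" "a \<bullet> (- v) \<le> 1" "b \<bullet> u \<le> 1" "b \<bullet> (- u) \<le> 1"
    using a(1) b(1) inK unfolding polar_body_def by blast+
  then have le: "\<bar>a \<bullet> v\<bar> \<le> 1" "\<bar>b \<bullet> u\<bar> \<le> 1"
    by (simp_all add: abs_le_iff)
  \<comment> \<open>The unknown numbers \<open>a \<bullet> v\<close> and \<open>b \<bullet> u\<close> cancel in the sum of the first two and in the sum of the
    last two values.\<close>
  have cross: "cross2 (- q) a = (2 / ?V) * (1 + a \<bullet> v)" "cross2 a p = (2 / ?V) * (1 - a \<bullet> v)"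
       "cross2 p b = (2 / ?V) * (1 - b \<bullet> u)" "cross2 b q = (2 / ?V) * (1 + b \<bullet> u)"
  proof -
    have "cross2 (- q) a = (2 / ?V) * (a \<bullet> u + a \<bullet> v)" "cross2 a p = (2 / ?V) * (a \<bullet> u - a \<bullet> v)"
         "cross2 p b = (2 / ?V) * (b \<bullet> v - b \<bullet> u)" "cross2 b q = (2 / ?V) * (b \<bullet> v + b \<bullet> u)"
      by (simp_all add: p_def q_def plane_simps add_divide_distrib diff_divide_distrib algebra_simps)
    then show "cross2 (- q) a = (2 / ?V) * (1 + a \<bullet> v)" "cross2 a p = (2 / ?V) * (1 - a \<bullet> v)"
       "cross2 p b = (2 / ?V) * (1 - b \<bullet> u)" "cross2 b q = (2 / ?V) * (1 + b \<bullet> u)"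
      by (simp_all only: a(2) b(2))
  qed
  have pq_pos: "cross2 p q > 0"
  proof -
    have "cross2 p q = (2 / ?V)\<^sup>2 * (2 * cross2 u v)"
      by (simp add: p_def q_def plane_simps power2_eq_square add_divide_distrib
          diff_divide_distrib algebra_simps)
    then show ?thesis using V uv by simp
  qed
  have nonneg: "cross2 (- q) a \<ge> 0" "cross2 a p \<ge> 0" "cross2 p b \<ge> 0" "cross2 b q \<ge> 0"
    unfolding cross using V le by auto
  have "- q \<in> polar_body K" using sym pq(2) by (simp add: origin_symmetric_iff)
  then have "(cross2 (- q) a + cross2 a p) / 2 \<le> measure lebesgue (polar_body K \<inter> wedge (- q) p)"
    using a(1) pq(1) 0 pq_pos cross2_commute[of q p]
    by (intro measure_wedge_ge_fan convex_polar_body K' nonneg) auto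
  moreover have "(cross2 p b + cross2 b q) / 2 \<le> measure lebesgue (polar_body K \<inter> wedge p q)"
    using b(1) pq 0 pq_pos by (intro measure_wedge_ge_fan convex_polar_body K' nonneg) auto
  moreover have "measure lebesgue (polar_body K) =
      2 * (measure lebesgue (polar_body K \<inter> wedge (- q) p) +
           measure lebesgue (polar_body K \<inter> wedge p q))"
    using measure_symmetric_eq_wedges[OF K' sym, of "- q" p] pq_pos by fastforce
  moreover have "(cross2 (- q) a + cross2 a p) / 2 = 2 / ?V" "(cross2 p b + cross2 b q) / 2 = 2 / ?V"
    unfolding cross by (simp_all flip: distrib_left add_divide_distrib)
  ultimately have "measure lebesgue (polar_body K) \<ge> 8 / ?V" by simp
  then show ?thesis
    using V by (simp add: volume_product_def field_simps)
qed

section \<open>The volume product of a square\<close>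

lemma
  fixes a b :: "real^2"
  assumes "r \<ge> 0"
  defines "Q \<equiv> {s *\<^sub>R a + t *\<^sub>R b | s t. \<bar>s\<bar> \<le> r \<and> \<bar>t\<bar> \<le> r}"
  shows lmeasurable_parallelogram: "Q \<in> lmeasurable"
    and measure_parallelogram: "measure lebesgue Q = 4 * r\<^sup>2 * \<bar>cross2 a b\<bar>"
proof -
  define f :: "real^2 \<Rightarrow> real^2" where "f y = y$1 *\<^sub>R a + y$2 *\<^sub>R b" for y
  let ?B = "cbox (vector [-r, -r]) (vector [r, r]) :: (real^2) set"
  have lin: "linear f" by (rule linearI) (simp_all add: f_def algebra_simps)
  have Q: "Q = f ` ?B"
  proof (intro set_eqI iffI)
    fix x assume "x \<in> Q"
    then obtain s t where "x = s *\<^sub>R a + t *\<^sub>R b" "\<bar>s\<bar> \<le> r" "\<bar>t\<bar> \<le> r" by (auto simp: Q_def)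
    then have "x = f (vector [s, t])" "vector [s, t] \<in> ?B"
      by (auto simp: f_def mem_box_cart forall_2 vector_2)
    then show "x \<in> f ` ?B" by blast
  next
    fix x assume "x \<in> f ` ?B"
    then obtain y :: "real^2" where "x = y$1 *\<^sub>R a + y$2 *\<^sub>R b" "\<bar>y$1\<bar> \<le> r" "\<bar>y$2\<bar> \<le> r"
      by (auto simp: f_def mem_box_cart forall_2 vector_2 abs_le_iff minus_le_iff)
    then show "x \<in> Q" unfolding Q_def by blast
  qed
  show "Q \<in> lmeasurable"
    unfolding Q using lin by (intro measurable_linear_image) auto
  have "0 \<in> ?B" using assms(1) by (simp add: mem_box_cart forall_2 vector_2)
  then have "?B \<noteq> {}" by blast
  then have "measure lebesgue ?B = 4 * r\<^sup>2"
    by (simp add: content_cbox_cart UNIV_2 vector_2 power2_eq_square)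
  moreover have "det (matrix f) = cross2 a b"
    by (simp add: det_2 matrix_def f_def cross2_def axis_def)
  ultimately show "measure lebesgue Q = 4 * r\<^sup>2 * \<bar>cross2 a b\<bar>"
    unfolding Q using lin by (subst measure_linear_image) auto
qed

lemma volume_product_square_le_8:
  assumes "square_centered_at 0 S"
  shows "volume_product S \<le> 8"
proof -
  obtain e f h where ef: "norm e = 1" "norm f = 1" "orthogonal e f" and h: "h > 0"
    and S: "S = {s *\<^sub>R e + t *\<^sub>R f | s t. \<bar>s\<bar> \<le> h \<and> \<bar>t\<bar> \<le> h}"
    using assms unfolding square_centered_at_def by auto
  have dots: "e \<bullet> e = 1" "f \<bullet> f = 1" "e \<bullet> f = 0"
    using ef by (simp_all add: norm_eq_1 orthogonal_def)
  have "(cross2 e f)\<^sup>2 + (e \<bullet> f)\<^sup>2 = (e \<bullet> e) * (f \<bullet> f)"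
    by (simp add: plane_simps power2_eq_square algebra_simps)
  then have "(cross2 e f)\<^sup>2 = 1" using dots by simp
  then have ef1: "\<bar>cross2 e f\<bar> = 1" by (simp add: power2_eq_1_iff) auto
  \<comment> \<open>The remainder \<open>y\<close> is orthogonal to the two independent vectors \<open>e\<close> and \<open>f\<close>.\<close>
  have expand: "x = (x \<bullet> e) *\<^sub>R e + (x \<bullet> f) *\<^sub>R f" for x
  proof -
    define y where "y = x - (x \<bullet> e) *\<^sub>R e - (x \<bullet> f) *\<^sub>R f"
    have "y \<bullet> e = 0" "y \<bullet> f = 0"
      using dots by (simp_all add: y_def inner_diff_left inner_commute[of f e])
    then have "cross2 e f * y$1 = 0" "cross2 e f * y$2 = 0"
      unfolding plane_simps by algebra+
    then have "y = 0" using ef1 by (auto simp: vec_eq_iff forall_2)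
    then show ?thesis by (simp add: y_def algebra_simps)
  qed
  \<comment> \<open>The vertices of the square confine its polar body to a square whose sides are parallel to
    the diagonals \<open>e + f\<close> and \<open>e - f\<close>.\<close>
  let ?D = "{s *\<^sub>R (e + f) + t *\<^sub>R (e - f) | s t. \<bar>s\<bar> \<le> 1 / (2 * h) \<and> \<bar>t\<bar> \<le> 1 / (2 * h)}"
  have "polar_body S \<subseteq> ?D"
  proof
    fix x assume x: "x \<in> polar_body S"
    have vertex: "s * (x \<bullet> e) + t * (x \<bullet> f) \<le> 1" if "\<bar>s\<bar> \<le> h" "\<bar>t\<bar> \<le> h" for s t
    proof -
      have "s *\<^sub>R e + t *\<^sub>R f \<in> S" using that unfolding S by blast
      then have "x \<bullet> (s *\<^sub>R e + t *\<^sub>R f) \<le> 1" using x by (auto simp: polar_body_def)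
      then show ?thesis by (simp add: inner_add_right)
    qed
    let ?s = "(x \<bullet> e + x \<bullet> f) / 2" and ?t = "(x \<bullet> e - x \<bullet> f) / 2"
    have "\<bar>?s\<bar> \<le> 1 / (2 * h)" "\<bar>?t\<bar> \<le> 1 / (2 * h)"
      using vertex[of h h] vertex[of h "-h"] vertex[of "-h" h] vertex[of "-h" "-h"] h
      by (auto simp: field_simps abs_le_iff)
    moreover have "x = ?s *\<^sub>R (e + f) + ?t *\<^sub>R (e - f)"
    proof -
      have "?s *\<^sub>R (e + f) + ?t *\<^sub>R (e - f) = (?s + ?t) *\<^sub>R e + (?s - ?t) *\<^sub>R f"
        by (simp add: scaleR_add_left scaleR_add_right scaleR_diff_left scaleR_diff_right)
      also have "\<dots> = x" using expand[of x] by (simp add: field_simps)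
      finally show ?thesis by simp
    qed
    ultimately show "x \<in> ?D" by blast
  qed
  then have "measure lebesgue (polar_body S) \<le> measure lebesgue ?D"
    using h by (intro measure_mono_fmeasurable lmeasurable_parallelogram)
      (auto simp: borel_closed closed_polar_body)
  also have "\<dots> = 4 * (1 / (2 * h))\<^sup>2 * \<bar>cross2 (e + f) (e - f)\<bar>"
    using h by (intro measure_parallelogram) simp
  also have "cross2 (e + f) (e - f) = - 2 * cross2 e f"
    by (simp add: cross2_def algebra_simps)
  also have "4 * (1 / (2 * h))\<^sup>2 * \<bar>- 2 * cross2 e f\<bar> = 2 / h\<^sup>2"
    using ef1 h by (simp add: abs_mult power_divide field_simps)
  finally have "measure lebesgue (polar_body S) \<le> 2 / h\<^sup>2" .
  moreover have "measure lebesgue S = 4 * h\<^sup>2"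
    unfolding S using measure_parallelogram[of h e f] h ef1 by simp
  ultimately show ?thesis
    using h by (simp add: volume_product_def field_simps)
qed

section \<open>Polygons\<close>

text \<open>With an interior point \<open>x\<close>, symmetry gives the interior point \<open>- x\<close>, and 0 is their midpoint.\<close>
lemma symmetric_convex_0_in_interior:
  fixes K :: "'a::euclidean_space set"
  assumes "convex K" "origin_symmetric K" "interior K \<noteq> {}"
  shows "0 \<in> interior K"
proof -
  obtain x where x: "x \<in> interior K" using assms(3) by blast
  have "uminus ` interior K = interior (uminus ` K)"
    by (rule interior_negations[symmetric])
  then have "- x \<in> interior K"
    using x assms(2) unfolding origin_symmetric_def by (metis imageI)
  then have "(1/2) *\<^sub>R x + (1/2) *\<^sub>R (- x) \<in> interior K"
    using x convex_interior[OF assms(1)] by (intro convexD) auto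
  then show ?thesis by simp
qed

theorem theorem3p4:
  fixes P S :: "(real^2) set"
  assumes "polygon P" and "origin_symmetric P"
    and "square_centered_at 0 S"
  shows "volume_product P \<ge> volume_product S"
proof -
  have P: "convex P" "compact P" "interior P \<noteq> {}"
    using assms(1) by (auto simp: polygon_def polytope_imp_convex polytope_imp_compact)
  then have "8 \<le> volume_product P"
    using assms(2) symmetric_convex_0_in_interior
    by (intro volume_product_symmetric_convex_ge_8) auto
  with volume_product_square_le_8[OF assms(3)] show ?thesis by linarith
qed

end
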